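(* For any $\epsilon>0$, no (deterministic online) algorithm can be $(1.25-\epsilon)$-competitive for open online TSP on the line under the LOCATIONS+FINAL prediction model, even when the predictions are perfect (errors $\eta=\delta=0$), against an adaptive adversary that chooses release times after observing the algorithm's moves.
   Context: Online TSP on the line: an agent starts at the origin at time $0$ and moves on the real line with speed at most $1$. There is a set $Q=\{q_1,\dots,q_n\}$ of requests, each with a position (also denoted $q_i$) and a release time; the algorithm knows $n$ in advance. A request $q$ is served at time $t$ if the agent was at position $q$ at some time $t'$ with $rel(q)\le t'\le t$. In the open variant the makespan $|ALG|$ is the first time at which all requests are served. $|OPT|$ is the optimal offline makespan; $c$-competitive means $|ALG|\le c|OPT|$ on every instance. Let $L=\min Q$, $R=\max Q$. LOCATIONS+FINAL prediction model: at time $0$ the algorithm receives predicted positions $p_1,\dots,p_n$ for $q_1,\dots,q_n$ and a label $f'$ predicting a request on which an optimal offline solution finishes; errors $\eta=\max_i|q_i-p_i|/(|L|+|R|)$ and $\delta=|q_{f'}-q_f|/(|L|+|R|)$, where $q_f$ is a request on which some optimal offline solution may finish, chosen closest to $q_{f'}$. *)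

theory Defs
  imports "HOL-Analysis.Analysis"
begin

record request =
  loc :: real
  rel :: real

text \<open>A request set \<open>q\<^sub>1, \<dots>, q\<^sub>n\<close> is the list of its requests; labels are list indices \<open>0, \<dots>, n - 1\<close>.\<close>

definition request_set :: "request list \<Rightarrow> bool" where
  "request_set Q \<longleftrightarrow> Q \<noteq> [] \<and> (\<forall>q\<in>set Q. 0 \<le> rel q)"

text \<open>Movement of the agent; only the values at times \<open>t \<ge> 0\<close> matter.\<close>

definition agent_path :: "(real \<Rightarrow> real) \<Rightarrow> bool" where
  "agent_path x \<longleftrightarrow> x 0 = 0 \<and> 1-lipschitz_on {0..} x"

definition served :: "(real \<Rightarrow> real) \<Rightarrow> request \<Rightarrow> real \<Rightarrow> bool" where
  "served x q t \<longleftrightarrow> (\<exists>t'. rel q \<le> t' \<and> t' \<le> t \<and> x t' = loc q)"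

text \<open>Times are extended reals, so that the value is \<open>\<infinity>\<close> when something is never served.\<close>

definition service_time :: "(real \<Rightarrow> real) \<Rightarrow> request \<Rightarrow> ereal" where
  "service_time x q = Inf {ereal t |t. served x q t}"

definition makespan :: "request list \<Rightarrow> (real \<Rightarrow> real) \<Rightarrow> ereal" where
  "makespan Q x = Inf {ereal t |t. \<forall>q\<in>set Q. served x q t}"

definition opt :: "request list \<Rightarrow> ereal" where
  "opt Q = (INF x\<in>Collect agent_path. makespan Q x)"

definition optimal_solution :: "request list \<Rightarrow> (real \<Rightarrow> real) \<Rightarrow> bool" where
  "optimal_solution Q x \<longleftrightarrow> agent_path x \<and> makespan Q x = opt Q"

definition finishes_on :: "request list \<Rightarrow> (real \<Rightarrow> real) \<Rightarrow> nat \<Rightarrow> bool" where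
  "finishes_on Q x f \<longleftrightarrow> f < length Q \<and> service_time x (Q ! f) = makespan Q x"

definition optimal_finals :: "request list \<Rightarrow> nat set" where
  "optimal_finals Q = {f. \<exists>x. optimal_solution Q x \<and> finishes_on Q x f}"

definition extent :: "request list \<Rightarrow> real" where
  "extent Q = \<bar>Min (loc ` set Q)\<bar> + \<bar>Max (loc ` set Q)\<bar>"

definition eta :: "request list \<Rightarrow> real list \<Rightarrow> real" where
  "eta Q p = Max ((\<lambda>i. \<bar>loc (Q ! i) - p ! i\<bar>) ` {..<length Q}) / extent Q"

text \<open>The minimum expresses that \<open>q\<^sub>f\<close> is the possible optimal final request closest to the
  request with the predicted label.\<close>

definition delta :: "request list \<Rightarrow> nat \<Rightarrow> real" where
  "delta Q f' = Min ((\<lambda>f. \<bar>loc (Q ! f') - loc (Q ! f)\<bar>) ` optimal_finals Q) / extent Q"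

text \<open>A LOCATIONS+FINAL prediction consists of \<open>n\<close> positions and a label.\<close>

definition prediction :: "request list \<Rightarrow> real list \<Rightarrow> nat \<Rightarrow> bool" where
  "prediction Q p f' \<longleftrightarrow> length p = length Q \<and> f' < length Q"

text \<open>The errors are undefined if all requests lie at the origin. Such request sets are excluded,
  since division by zero would make every prediction of their positions count as perfect.\<close>

definition perfect_prediction :: "request list \<Rightarrow> real list \<Rightarrow> nat \<Rightarrow> bool" where
  "perfect_prediction Q p f' \<longleftrightarrow>
     prediction Q p f' \<and> 0 < extent Q \<and> eta Q p = 0 \<and> delta Q f' = 0"

definition released :: "request list \<Rightarrow> real \<Rightarrow> (nat \<times> request) set" where
  "released Q t = {(i, Q ! i) |i. i < length Q \<and> rel (Q ! i) \<le> t}"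

text \<open>A deterministic online algorithm chooses the position of the agent at time \<open>t\<close> as a function of
  the predicted positions (whose number is \<open>n\<close>), the predicted label, the time, and the requests
  released by time \<open>t\<close>, with their labels and release times. Its own earlier moves are
  determined by these data, so they need not be arguments.\<close>

type_synonym algorithm = "real list \<Rightarrow> nat \<Rightarrow> real \<Rightarrow> (nat \<times> request) set \<Rightarrow> real"

definition run :: "algorithm \<Rightarrow> real list \<Rightarrow> nat \<Rightarrow> request list \<Rightarrow> real \<Rightarrow> real" where
  "run A p f' Q t = A p f' t (released Q t)"

definition online_algorithm :: "algorithm \<Rightarrow> bool" where
  "online_algorithm A \<longleftrightarrow>
     (\<forall>Q p f'. request_set Q \<and> prediction Q p f' \<longrightarrow> agent_path (run A p f' Q))"

text \<open>An adaptive adversary fixes the positions in advance, and chooses the release times in response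
  to the movement of the agent. The last conjunct makes it non-anticipating: what is released up to
  time \<open>t\<close> depends only on the movement up to time \<open>t\<close>.\<close>

definition adaptive_adversary :: "((real \<Rightarrow> real) \<Rightarrow> request list) \<Rightarrow> bool" where
  "adaptive_adversary S \<longleftrightarrow>
     (\<forall>x. request_set (S x)) \<and>
     (\<forall>x y. map loc (S x) = map loc (S y)) \<and>
     (\<forall>x y t. (\<forall>s\<in>{0..t}. x s = y s) \<longrightarrow> released (S x) t = released (S y) t)"

text \<open>A request set \<open>Q\<close> arises from the interaction of \<open>A\<close> and \<open>S\<close> if the movement of \<open>A\<close> on \<open>Q\<close> makes
  \<open>S\<close> release exactly \<open>Q\<close>. Constant strategies are the fixed instances.\<close>

definition outcome ::
  "algorithm \<Rightarrow> real list \<Rightarrow> nat \<Rightarrow> ((real \<Rightarrow> real) \<Rightarrow> request list) \<Rightarrow> request list \<Rightarrow> bool" where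
  "outcome A p f' S Q \<longleftrightarrow> S (run A p f' Q) = Q"

definition competitive_perfect_adaptive :: "real \<Rightarrow> algorithm \<Rightarrow> bool" where
  "competitive_perfect_adaptive c A \<longleftrightarrow>
     (\<forall>S p f' Q. adaptive_adversary S \<and> outcome A p f' S Q \<and> perfect_prediction Q p f' \<longrightarrow>
        makespan Q (run A p f' Q) \<le> ereal c * opt Q)"

end

theory Submission
  imports Defs
begin

text \<open>The requests lie at \<open>-1\<close>, \<open>0\<close> and \<open>1\<close>, and the final request \<open>0\<close> is released at time \<open>4\<close>. At time
  \<open>1\<close> the adversary releases an endpoint \<open>s \<in> {-1, 1}\<close> on the side where the agent is not (\<open>s x(1) \<le> 0\<close>),
  and it releases \<open>-s\<close> at time \<open>3\<close>. The tour \<open>0, s, -s, 0\<close> has makespan \<open>4\<close>, but the agent cannot reach \<open>s\<close>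
  before time \<open>2\<close>, and then no order of visits finishes before time \<open>5\<close>.\<close>

definition side_instance :: "real \<Rightarrow> request list" where
  "side_instance s =
     [\<lparr>loc = - 1, rel = 2 + s\<rparr>, \<lparr>loc = 0, rel = 4\<rparr>, \<lparr>loc = 1, rel = 2 - s\<rparr>]"

text \<open>The list of positions is the same for both sides, as is required of an adversary; only
  the release times \<open>2 + s\<close> and \<open>2 - s\<close> react to the movement.\<close>

definition opposite_side_adversary :: "(real \<Rightarrow> real) \<Rightarrow> request list" where
  "opposite_side_adversary x = side_instance (if x 1 \<le> 0 then 1 else - 1)"

lemma agent_path_dist_le:
  assumes "agent_path x" "0 \<le> t" "0 \<le> u"
  shows "\<bar>x t - x u\<bar> \<le> \<bar>t - u\<bar>"
  using assms lipschitz_onD[of 1 "{0..}" x t u]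
  by (auto simp: agent_path_def dist_real_def)

lemma servedI: "rel q \<le> t' \<Longrightarrow> t' \<le> t \<Longrightarrow> x t' = loc q \<Longrightarrow> served x q t"
  by (auto simp: served_def)

lemma makespan_ge:
  assumes "\<And>t. \<forall>q\<in>set Q. served x q t \<Longrightarrow> m \<le> t"
  shows "ereal m \<le> makespan Q x"
  unfolding makespan_def using assms by (auto intro!: Inf_greatest)

lemma makespan_le:
  assumes "\<forall>q\<in>set Q. served x q m"
  shows "makespan Q x \<le> ereal m"
  unfolding makespan_def using assms by (auto intro!: Inf_lower)

lemma service_time_eqI:
  assumes "served x q m" "m \<le> rel q"
  shows "service_time x q = ereal m"
  unfolding service_time_def
proof (rule antisym)
  show "Inf {ereal t |t. served x q t} \<le> ereal m"
    using assms(1) by (auto intro!: Inf_lower)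
  show "ereal m \<le> Inf {ereal t |t. served x q t}"
    using assms(2) by (auto intro!: Inf_greatest simp: served_def)
qed

text \<open>Before time 1 the two sides cannot be told apart. This serves twice: it makes the
  adversary non-anticipating, and it keeps the algorithm from learning the side in advance.\<close>

lemma released_side_instance_before:
  assumes "\<bar>s\<bar> = 1" "t < 1"
  shows "released (side_instance s) t = {}"
  using assms by (auto simp: released_def side_instance_def nth_Cons split: nat.splits)

lemma length_side_instance: "length (side_instance s) = 3"
  by (simp add: side_instance_def)

lemma request_set_side_instance: "\<bar>s\<bar> = 1 \<Longrightarrow> request_set (side_instance s)"
  by (auto simp: request_set_def side_instance_def)

lemma adaptive_opposite_side_adversary: "adaptive_adversary opposite_side_adversary"
  unfolding adaptive_adversary_def
proof (intro conjI allI impI)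
  fix x y :: "real \<Rightarrow> real" and t :: real
  show "request_set (opposite_side_adversary x)"
    by (simp add: opposite_side_adversary_def request_set_side_instance)
  show "map loc (opposite_side_adversary x) = map loc (opposite_side_adversary y)"
    by (simp add: opposite_side_adversary_def side_instance_def)
  assume eq: "\<forall>s\<in>{0..t}. x s = y s"
  show "released (opposite_side_adversary x) t = released (opposite_side_adversary y) t"
  proof (cases "t < 1")
    case True
    then show ?thesis
      by (simp add: opposite_side_adversary_def released_side_instance_before)
  next
    case False
    then have "x 1 = y 1" using eq by simp
    then show ?thesis by (simp add: opposite_side_adversary_def)
  qed
qed

text \<open>The branches \<open>t\<close>, \<open>2 - t\<close> and \<open>t - 4\<close> meet at the
  turning times 1 and 3, when the endpoints \<open>s\<close> and \<open>- s\<close> are reached just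
  as they are released.\<close>

definition side_tour :: "real \<Rightarrow> real \<Rightarrow> real" where
  "side_tour s t = s * min t (max (2 - t) (t - 4))"

lemma agent_path_side_tour:
  assumes "\<bar>s\<bar> = 1"
  shows "agent_path (side_tour s)"
proof -
  have "\<bar>side_tour s t - side_tour s u\<bar> \<le> \<bar>t - u\<bar>" for t u
  proof -
    have "\<bar>side_tour s t - side_tour s u\<bar>
        = \<bar>s\<bar> * \<bar>min t (max (2 - t) (t - 4)) - min u (max (2 - u) (u - 4))\<bar>"
      by (simp add: side_tour_def flip: abs_mult right_diff_distrib)
    also have "\<dots> \<le> \<bar>t - u\<bar>"
      unfolding assms by (auto simp: min_def max_def)
    finally show ?thesis .
  qed
  then show ?thesis
    by (auto simp: agent_path_def side_tour_def dist_real_def intro!: lipschitz_onI)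
qed

lemma served_side_tour:
  assumes "\<bar>s\<bar> = 1"
  shows "\<forall>q\<in>set (side_instance s). served (side_tour s) q 4"
proof -
  have *: "side_tour s 1 = s" "side_tour s 3 = - s" "side_tour s 4 = 0"
    by (simp_all add: side_tour_def)
  have "s = 1 \<or> s = - 1" using assms by linarith
  then show ?thesis
    using * servedI[of _ 1 4] servedI[of _ 3 4] servedI[of _ 4 4]
    by (auto simp: side_instance_def)
qed

lemma makespan_side_instance_ge: "ereal 4 \<le> makespan (side_instance s) x"
  by (rule makespan_ge) (auto simp: side_instance_def served_def)

lemma makespan_side_tour: "\<bar>s\<bar> = 1 \<Longrightarrow> makespan (side_instance s) (side_tour s) = ereal 4"
  by (rule antisym[OF makespan_le makespan_side_instance_ge]) (rule served_side_tour)

lemma opt_side_instance: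
  assumes "\<bar>s\<bar> = 1"
  shows "opt (side_instance s) = ereal 4"
proof (rule antisym)
  have "opt (side_instance s) \<le> makespan (side_instance s) (side_tour s)"
    unfolding opt_def by (rule INF_lower) (simp add: agent_path_side_tour assms)
  then show "opt (side_instance s) \<le> ereal 4" by (simp add: makespan_side_tour assms)
  show "ereal 4 \<le> opt (side_instance s)"
    unfolding opt_def by (intro INF_greatest makespan_side_instance_ge)
qed

text \<open>The tour is optimal, and the request at 0, which has index 1, is released only at time
  4, the makespan.\<close>

lemma optimal_final_side_instance:
  assumes "\<bar>s\<bar> = 1"
  shows "1 \<in> optimal_finals (side_instance s)"
proof -
  have "service_time (side_tour s) (side_instance s ! 1) = ereal 4"
    using served_side_tour[OF assms] by (intro service_time_eqI) (auto simp: side_instance_def)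
  then have "finishes_on (side_instance s) (side_tour s) 1"
    by (simp add: finishes_on_def makespan_side_tour assms) (simp add: side_instance_def)
  then show ?thesis
    using assms unfolding optimal_finals_def optimal_solution_def
    by (intro CollectI exI[of _ "side_tour s"])
      (simp add: agent_path_side_tour makespan_side_tour opt_side_instance)
qed

lemma finite_optimal_finals: "finite (optimal_finals Q)"
  by (rule finite_subset[of _ "{..<length Q}"]) (auto simp: optimal_finals_def finishes_on_def)

lemma delta_eq_0:
  assumes "f \<in> optimal_finals Q"
  shows "delta Q f = 0"
proof -
  have "Min ((\<lambda>g. \<bar>loc (Q ! f) - loc (Q ! g)\<bar>) ` optimal_finals Q) = 0"
    using assms by (intro Min_eqI finite_imageI finite_optimal_finals) (auto intro: rev_image_eqI)
  then show ?thesis by (simp add: delta_def)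
qed

text \<open>Neither the predicted positions nor the label depend on \<open>s\<close>, so a perfect
  prediction does not reveal the side.\<close>

lemma perfect_prediction_side_instance:
  assumes "\<bar>s\<bar> = 1"
  shows "perfect_prediction (side_instance s) [- 1, 0, 1] 1"
proof -
  have "eta (side_instance s) [- 1, 0, 1] = 0"
    by (simp add: eta_def side_instance_def lessThan_Suc)
  moreover have "extent (side_instance s) = 2"
    by (simp add: extent_def side_instance_def)
  moreover have "prediction (side_instance s) [- 1, 0, 1] 1"
    by (simp add: prediction_def length_side_instance)
  ultimately show ?thesis
    using delta_eq_0[OF optimal_final_side_instance[OF assms]]
    by (simp add: perfect_prediction_def)
qed

lemma makespan_opposite_side_ge:
  assumes x: "agent_path x" and s: "\<bar>s\<bar> = 1" and opp: "s * x 1 \<le> 0"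
  shows "ereal 5 \<le> makespan (side_instance s) x"
proof (rule makespan_ge)
  fix t assume t: "\<forall>q\<in>set (side_instance s). served x q t"
  have "s = 1 \<or> s = - 1" using s by linarith
  then obtain a b where a: "1 \<le> a" "a \<le> t" "x a = s" and b: "3 \<le> b" "b \<le> t" "x b = - s"
    using t by (auto simp: side_instance_def served_def)
  obtain c where c: "4 \<le> c" "c \<le> t" "x c = 0"
    using t by (auto simp: side_instance_def served_def)
  note d = agent_path_dist_le[OF x]
  have "1 \<le> \<bar>s - x 1\<bar>" using \<open>s = 1 \<or> s = - 1\<close> opp by auto
  then have "2 \<le> a" using d[of a 1] a by auto
  moreover have "2 \<le> \<bar>a - b\<bar>" "1 \<le> \<bar>a - c\<bar>" "1 \<le> \<bar>b - c\<bar>"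
    using d[of a b] d[of a c] d[of b c] a b c s by auto
  \<comment> \<open>If an endpoint comes last, its visit is at least 1 after \<open>c\<close>, and
    \<open>c\<close> is at least 4. If 0 comes last, the visits happen no earlier than 2, 4, 5 in
    the order \<open>s\<close>, \<open>- s\<close>, 0, and no earlier than 3, 5, 6 in the order
    \<open>- s\<close>, \<open>s\<close>, 0.\<close>
  ultimately show "5 \<le> t" using a b c by linarith
qed

text \<open>On the two instances the agent may see different requests at time \<open>1\<close>, but its position there is
  the limit of its positions before time \<open>1\<close>, when nothing is released.\<close>

lemma run_side_instance_at_1:
  assumes A: "online_algorithm A" and s: "\<bar>s\<bar> = 1" "\<bar>s'\<bar> = 1"
    and p: "length p = 3" "f < 3"
  shows "run A p f (side_instance s) 1 = run A p f (side_instance s') 1"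
proof -
  let ?x = "run A p f (side_instance s)" and ?y = "run A p f (side_instance s')"
  have paths: "agent_path ?x" "agent_path ?y"
    using A s p by (simp_all add: online_algorithm_def request_set_side_instance prediction_def
        length_side_instance)
  have "\<bar>?x 1 - ?y 1\<bar> \<le> 0 + e" if "0 < e" for e
  proof -
    \<comment> \<open>From \<open>t\<close> to 1 each path moves by at most \<open>e / 2\<close>;
      the maximum keeps \<open>t\<close> in the domain of the Lipschitz bound.\<close>
    define t where "t = max 0 (1 - e / 2)"
    have t: "0 \<le> t" "t < 1" "1 - t \<le> e / 2" using that by (simp_all add: t_def max_def)
    have "?x t = ?y t"
      using s t by (simp add: run_def released_side_instance_before)
    then show ?thesis
      using agent_path_dist_le[OF paths(1), of 1 t] agent_path_dist_le[OF paths(2), of 1 t] t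
      by linarith
  qed
  then have "\<bar>?x 1 - ?y 1\<bar> \<le> 0" by (rule field_le_epsilon)
  then show ?thesis by simp
qed

theorem theorem6:
  fixes \<epsilon> :: real
  assumes "\<epsilon> > 0"
  shows "\<not> (\<exists>A. online_algorithm A \<and> competitive_perfect_adaptive (1.25 - \<epsilon>) A)"
proof
  assume "\<exists>A. online_algorithm A \<and> competitive_perfect_adaptive (1.25 - \<epsilon>) A"
  then obtain A where A: "online_algorithm A" "competitive_perfect_adaptive (1.25 - \<epsilon>) A"
    by blast
  let ?p = "[- 1, 0, 1] :: real list"
  let ?x = "\<lambda>s. run A ?p 1 (side_instance s)"
  \<comment> \<open>An outcome is a fixed point: the side must fit the run on the instance with that
    very side. Reading it off the run for side 1 avoids the circle, because by \<open>at_1\<close>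
    the position at time 1 is the same for either side.\<close>
  define s :: real where "s = (if ?x 1 1 \<le> 0 then 1 else - 1)"
  have s: "\<bar>s\<bar> = 1" by (simp add: s_def)
  have at_1: "?x s 1 = ?x 1 1"
    by (rule run_side_instance_at_1) (use A s in simp_all)
  have path: "agent_path (?x s)"
    using A(1) request_set_side_instance[OF s]
      perfect_prediction_side_instance[OF s, unfolded perfect_prediction_def]
    by (simp add: online_algorithm_def)
  have "outcome A ?p 1 opposite_side_adversary (side_instance s)"
    unfolding outcome_def opposite_side_adversary_def at_1 by (simp add: s_def)
  then have "makespan (side_instance s) (?x s) \<le> ereal (1.25 - \<epsilon>) * opt (side_instance s)"
    using A(2) adaptive_opposite_side_adversary perfect_prediction_side_instance[OF s]
    unfolding competitive_perfect_adaptive_def by blast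
  moreover have "ereal 5 \<le> makespan (side_instance s) (?x s)"
    by (rule makespan_opposite_side_ge[OF path s]) (use at_1 in \<open>simp add: s_def\<close>)
  ultimately have "ereal 5 \<le> ereal (1.25 - \<epsilon>) * ereal 4"
    unfolding opt_side_instance[OF s] by (rule order_trans[rotated])
  \<comment> \<open>The right-hand side is 5 - 4 \<epsilon>.\<close>
  then show False using assms by simp
qed

end
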